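(* Let $\tau \colon \mathcal A^* \to \mathcal A^*$ be a primitive aperiodic substitution. Then $X_\tau$ is letter-balanced if and only if the vector-space sum $\vec V_{X_\tau}+\vec{\mathcal C}_{X_\tau}$ has codimension $1$ in $\mathbb R^{\mathcal A}$.
   Context: $\mathcal A$ is a finite alphabet with at least two letters, $\mathcal A^*$ the free monoid over it. A substitution $\tau:\mathcal A^*\to\mathcal A^*$ is a monoid morphism such that each $\tau(a)$, $a\in\mathcal A$, is non-empty and each letter occurs in some $\tau(a)$. Its incidence matrix $M_\tau$ is the $\mathcal A\times\mathcal A$ matrix whose $(b,a)$ entry is the number of occurrences of $b$ in $\tau(a)$; $\tau$ is primitive if some power of $M_\tau$ has only strictly positive entries. $X_\tau\subseteq\mathcal A^{\mathbb Z}$ is the subshift of all $x$ such that every finite factor of $x$ occurs in $\tau^n(a)$ for some $n\ge1$ and $a\in\mathcal A$; $\tau$ is aperiodic if $X_\tau$ has no shift-periodic point. $\mathcal L(X_\tau)$ is the set of finite words occurring in points of $X_\tau$. $X_\tau$ is letter-balanced if for each letter $a$ there is a constant $C_a$ such that for all $w,w'\in\mathcal L(X_\tau)$ with $|w|=|w'|$ the numbers of occurrences of $a$ in $w$ and in $w'$ differ by at most $C_a$. Elements of $\mathbb R^{\mathcal A}$ are viewed as row vectors on which $M_\tau$ acts on the right. The stable space is $\vec V_{X_\tau}=\{\vec v\in\mathbb R^{\mathcal A}:\vec vM_\tau^n\to\vec0\text{ as }n\to\infty\}$. The coboundary space is $\vec{\mathcal C}_{X_\tau}=\{(c(a))_{a\in\mathcal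 A}: c \text{ is a letter-coboundary on } X_\tau\}$, where a letter-coboundary on $X_\tau$ is a monoid morphism $c:\mathcal A^*\to(\mathbb R,+)$ such that $c(w)=0$ for every letter $a$ and every return word $w$ to $a$, i.e. every word $w$ such that $wa\in\mathcal L(X_\tau)$ and $wa$ contains exactly two occurrences of $a$, one as a prefix and one as a suffix. *)

theory Defs
  imports "HOL-Analysis.Analysis" "HOL-Library.Sublist" "HOL-Library.Set_Algebras"
begin

definition substitution :: "('a::finite list \<Rightarrow> 'a list) \<Rightarrow> bool" where
  "substitution \<tau> \<longleftrightarrow>
     (\<forall>u v. \<tau> (u @ v) = \<tau> u @ \<tau> v) \<and>
     (\<forall>a. \<tau> [a] \<noteq> []) \<and>
     (\<forall>b. \<exists>a. b \<in> set (\<tau> [a]))"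

definition incidence_matrix :: "('a::finite list \<Rightarrow> 'a list) \<Rightarrow> real^'a^'a" where
  "incidence_matrix \<tau> = (\<chi> b a. real (count_list (\<tau> [a]) b))"

(* The library's ^ acts componentwise on real^'n^'n, so it is not the matrix power. *)
primrec matrix_power :: "real^'n^'n::finite \<Rightarrow> nat \<Rightarrow> real^'n^'n" where
  "matrix_power M 0 = mat 1"
| "matrix_power M (Suc n) = matrix_power M n ** M"

definition primitive :: "('a::finite list \<Rightarrow> 'a list) \<Rightarrow> bool" where
  "primitive \<tau> \<longleftrightarrow> (\<exists>n\<ge>1. \<forall>b a. matrix_power (incidence_matrix \<tau>) n $ b $ a > 0)"

definition factor :: "(int \<Rightarrow> 'a) \<Rightarrow> int \<Rightarrow> nat \<Rightarrow> 'a list" where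
  "factor x i n = map (\<lambda>j. x (i + int j)) [0..<n]"

definition subst_shift :: "('a list \<Rightarrow> 'a list) \<Rightarrow> (int \<Rightarrow> 'a) set" where
  "subst_shift \<tau> = {x. \<forall>i n. \<exists>k\<ge>1. \<exists>a. sublist (factor x i n) ((\<tau> ^^ k) [a])}"

definition shift_periodic :: "(int \<Rightarrow> 'a) \<Rightarrow> bool" where
  "shift_periodic x \<longleftrightarrow> (\<exists>p\<ge>1. \<forall>i. x (i + p) = x i)"

definition aperiodic :: "('a list \<Rightarrow> 'a list) \<Rightarrow> bool" where
  "aperiodic \<tau> \<longleftrightarrow> \<not> (\<exists>x\<in>subst_shift \<tau>. shift_periodic x)"

definition language :: "(int \<Rightarrow> 'a) set \<Rightarrow> 'a list set" where
  "language X = {factor x i n | x i n. x \<in> X}"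

definition letter_balanced :: "(int \<Rightarrow> 'a) set \<Rightarrow> bool" where
  "letter_balanced X \<longleftrightarrow>
     (\<forall>a. \<exists>C::real. \<forall>w\<in>language X. \<forall>w'\<in>language X. length w = length w' \<longrightarrow>
        \<bar>real (count_list w a) - real (count_list w' a)\<bar> \<le> C)"

definition stable_space :: "('a::finite list \<Rightarrow> 'a list) \<Rightarrow> (real^'a) set" where
  "stable_space \<tau> = {v. (\<lambda>n. v v* matrix_power (incidence_matrix \<tau>) n) \<longlonglongrightarrow> 0}"

definition return_word :: "(int \<Rightarrow> 'a) set \<Rightarrow> 'a \<Rightarrow> 'a list \<Rightarrow> bool" where
  "return_word X a w \<longleftrightarrow>
     w @ [a] \<in> language X \<and> count_list (w @ [a]) a = 2 \<and>
     prefix [a] (w @ [a]) \<and> suffix [a] (w @ [a])"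

definition letter_coboundary :: "(int \<Rightarrow> 'a) set \<Rightarrow> ('a list \<Rightarrow> real) \<Rightarrow> bool" where
  "letter_coboundary X c \<longleftrightarrow>
     (\<forall>u v. c (u @ v) = c u + c v) \<and> (\<forall>a w. return_word X a w \<longrightarrow> c w = 0)"

definition coboundary_space :: "(int \<Rightarrow> 'a::finite) set \<Rightarrow> (real^'a) set" where
  "coboundary_space X = {\<chi> a. c [a] | c. letter_coboundary X c}"

(* Only meaningful for subspaces, since dim S is the dimension of span S; the lemmas below
   show that the sum considered is one. *)
definition codim :: "'v::euclidean_space set \<Rightarrow> nat" where
  "codim S = DIM('v) - dim S"

lemma subspace_stable_space: "subspace (stable_space \<tau>)"
proof (rule subspaceI)
  show "0 \<in> stable_space \<tau>"
    by (simp add: stable_space_def)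
next
  fix x y assume "x \<in> stable_space \<tau>" "y \<in> stable_space \<tau>"
  then show "x + y \<in> stable_space \<tau>"
    unfolding stable_space_def
    by (auto simp: vector_matrix_left_distrib intro: tendsto_add_zero)
next
  fix r :: real and x assume "x \<in> stable_space \<tau>"
  then have "(\<lambda>n. r *\<^sub>R (x v* matrix_power (incidence_matrix \<tau>) n)) \<longlonglongrightarrow> r *\<^sub>R 0"
    unfolding stable_space_def by (intro tendsto_scaleR tendsto_const) simp
  then show "r *\<^sub>R x \<in> stable_space \<tau>"
    by (simp add: stable_space_def scaleR_vector_matrix_assoc)
qed

lemma subspace_coboundary_space:
  fixes X :: "(int \<Rightarrow> 'a::finite) set"
  shows "subspace (coboundary_space X)"
proof (rule subspaceI)
  have "letter_coboundary X (\<lambda>_. 0)"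
    by (simp add: letter_coboundary_def)
  moreover have "(0 :: real^'a) = (\<chi> a. 0)"
    by (simp add: vec_eq_iff)
  ultimately show "0 \<in> coboundary_space X"
    unfolding coboundary_space_def by (intro CollectI exI[of _ "\<lambda>_. 0"]) simp
next
  fix x y assume "x \<in> coboundary_space X" "y \<in> coboundary_space X"
  then obtain c d where "x = (\<chi> a. c [a])" "y = (\<chi> a. d [a])"
    and "letter_coboundary X c" "letter_coboundary X d"
    unfolding coboundary_space_def by blast
  then have "letter_coboundary X (\<lambda>w. c w + d w)" "x + y = (\<chi> a. c [a] + d [a])"
    by (auto simp: letter_coboundary_def vec_eq_iff)
  then show "x + y \<in> coboundary_space X"
    unfolding coboundary_space_def by (intro CollectI exI[of _ "\<lambda>w. c w + d w"]) simp
next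
  fix r :: real and x assume "x \<in> coboundary_space X"
  then obtain c where "x = (\<chi> a. c [a])" "letter_coboundary X c"
    unfolding coboundary_space_def by blast
  then have "letter_coboundary X (\<lambda>w. r * c w)" "r *\<^sub>R x = (\<chi> a. r * c [a])"
    by (auto simp: letter_coboundary_def vec_eq_iff distrib_left)
  then show "r *\<^sub>R x \<in> coboundary_space X"
    unfolding coboundary_space_def by (intro CollectI exI[of _ "\<lambda>w. r * c w"]) simp
qed

lemma subspace_stable_plus_coboundary:
  "subspace (stable_space \<tau> + coboundary_space X)"
  using subspace_sums[OF subspace_stable_space subspace_coboundary_space]
  by (rule back_subst[where P = subspace]) (auto simp: set_plus_def)

end

theory Submission
  imports Defs
begin

text \<open>A vector \<open>v\<close> assigns to each word its \<^emph>\<open>weight\<close>, the sum of \<open>v\<close> over its letters. Applying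
  the incidence matrix to \<open>v\<close> on the right corresponds to applying \<open>\<tau>\<close> to the words:
  \<open>weight (v M) w = weight v (\<tau> w)\<close>. Everything is expressed through the space \<open>D\<close> of those vectors
  whose weights are bounded on the language of the subshift.

  On the one hand, balance means that \<open>D\<close> has codimension one: counting a letter is, up to a bounded
  error, a multiple of the length, and the length itself is the weight of the constant vector, which
  does not lie in \<open>D\<close> (\<open>letter_balanced_iff_codim_bounded_weights\<close>).

  On the other hand, \<open>D\<close> is the sum of the stable space and the coboundary space
  (\<open>bounded_weights_eq_stable_plus_coboundary\<close>). Stable vectors decay geometrically under \<open>M\<close>, so
  desubstituting a word level by level bounds its weight by a convergent series
  (\<open>abs_weight_iterated_image\<close>). Coboundaries have bounded weights because a word splits into return
  words and at most one further letter for each element of the alphabet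
  (\<open>abs_coboundary_weight_le\<close>).

  For the converse inclusion let \<open>v\<close> be in \<open>D\<close>. The space \<open>D\<close> is invariant under \<open>M\<close> and all orbits
  in it are bounded, so \<open>v\<close> differs by a stable vector from some limit point \<open>c\<close> of its own orbit
  (\<open>bounded_orbit_splitting\<close>). If \<open>w\<close> is a return word to \<open>a\<close>, then \<open>\<tau>\<^sup>n(w)\<close> leads from one occurrence
  of the long word \<open>\<tau>\<^sup>n(a)\<close> to another. A function on the subshift whose coboundary is the bounded
  cocycle given by \<open>v\<close> would be continuous, by minimality, and would take nearly the same value at
  both places. The weight of \<open>\<tau>\<^sup>n(w)\<close> therefore tends to zero, and \<open>c\<close> is a coboundary. The
  lemma \<open>eventually_weight_image_le\<close> carries this out for words, with a word of nearly maximal weight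
  in the role of the continuous function.\<close>

section \<open>Orbits of a linear map\<close>

lemma linear_funpow:
  fixes T :: "'v::real_vector \<Rightarrow> 'v"
  assumes "linear T"
  shows "linear (T ^^ n)"
proof (induction n)
  case 0
  show ?case by (simp add: linear_id[unfolded id_def] id_def)
next
  case (Suc n)
  show ?case using linear_compose[OF Suc.IH assms] by (simp add: comp_def)
qed

text \<open>On a subspace, finitely many vectors control the operator norms of all linear maps at once:
  expand in an orthonormal basis. This turns statements about single orbits into uniform ones.\<close>

lemma subspace_operator_norm_bound:
  fixes S :: "'v::euclidean_space set"
  assumes "subspace S"
  obtains B where "finite B" "B \<subseteq> S"
    "\<And>(L :: 'v \<Rightarrow> 'w::real_normed_vector) x. linear L \<Longrightarrow> x \<in> S \<Longrightarrow>
       norm (L x) \<le> norm x * (\<Sum>b\<in>B. norm (L b))"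
proof -
  obtain B where B: "B \<subseteq> S" "pairwise orthogonal B" "\<And>x. x \<in> B \<Longrightarrow> norm x = 1"
    "independent B" "span B = S"
    using orthonormal_basis_subspace[OF assms] by metis
  have fin: "finite B" using B(4) by (rule independent_imp_finite)
  show thesis
  proof (rule that[OF fin B(1)])
    fix L :: "'v \<Rightarrow> 'w" and x assume L: "linear L" and x: "x \<in> S"
    have "L x = L (\<Sum>b\<in>B. (x \<bullet> b) *\<^sub>R b)"
      using orthonormal_basis_expand[OF B(2,3) _ fin, of x] x B(5) by simp
    also have "\<dots> = (\<Sum>b\<in>B. (x \<bullet> b) *\<^sub>R L b)"
      by (simp add: linear_sum[OF L] linear_cmul[OF L])
    also have "norm \<dots> \<le> (\<Sum>b\<in>B. \<bar>x \<bullet> b\<bar> * norm (L b))"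
      by (rule order_trans[OF norm_sum]) simp
    also have "\<dots> \<le> (\<Sum>b\<in>B. norm x * norm (L b))"
    proof (intro sum_mono mult_right_mono)
      fix b assume "b \<in> B"
      then show "\<bar>x \<bullet> b\<bar> \<le> norm x"
        using Cauchy_Schwarz_ineq2[of x b] B(3) by simp
    qed simp
    finally show "norm (L x) \<le> norm x * (\<Sum>b\<in>B. norm (L b))"
      by (simp add: sum_distrib_left)
  qed
qed

text \<open>In finite dimension, pointwise convergence of the powers to zero on an invariant subspace is
  uniform on its unit ball, so some power is a contraction by one half and the decay is
  geometric.\<close>

lemma summable_norm_orbit:
  fixes T :: "'v::euclidean_space \<Rightarrow> 'v"
  assumes T: "linear T" and v: "(\<lambda>n. (T ^^ n) v) \<longlonglongrightarrow> 0"
  shows "summable (\<lambda>n. norm ((T ^^ n) v))"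
proof -
  define S where "S = {x. (\<lambda>n. (T ^^ n) x) \<longlonglongrightarrow> 0}"
  have lin: "linear (T ^^ n)" for n by (rule linear_funpow[OF T])
  have "subspace S"
  proof (rule subspaceI)
    show "0 \<in> S" by (simp add: S_def linear_0[OF lin])
    show "x + y \<in> S" if "x \<in> S" "y \<in> S" for x y
      using that tendsto_add[of "\<lambda>n. (T ^^ n) x" 0 sequentially "\<lambda>n. (T ^^ n) y" 0]
      by (simp add: S_def linear_add[OF lin])
    show "c *\<^sub>R x \<in> S" if "x \<in> S" for c x
      using that tendsto_scaleR[OF tendsto_const[of c], of "\<lambda>n. (T ^^ n) x" 0 sequentially]
      by (simp add: S_def linear_cmul[OF lin])
  qed
  then obtain B where B: "finite B" "B \<subseteq> S"
    "\<And>(L :: 'v \<Rightarrow> 'v) x. linear L \<Longrightarrow> x \<in> S \<Longrightarrow> norm (L x) \<le> norm x * (\<Sum>b\<in>B. norm (L b))"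
    using subspace_operator_norm_bound[where 'w='v] by metis
  have "(\<lambda>n. \<Sum>b\<in>B. norm ((T ^^ n) b)) \<longlonglongrightarrow> 0"
    using B(2) by (intro tendsto_null_sum) (auto simp: S_def tendsto_norm_zero)
  then have "\<forall>\<^sub>F n in sequentially. (\<Sum>b\<in>B. norm ((T ^^ n) b)) < 1/2"
    by (rule order_tendstoD) simp
  then obtain N where N: "\<And>n. n \<ge> N \<Longrightarrow> (\<Sum>b\<in>B. norm ((T ^^ n) b)) < 1/2"
    by (auto simp: eventually_sequentially)
  define p where "p = Suc N"
  have S_funpow: "(T ^^ n) v \<in> S" for n
  proof -
    have "(\<lambda>k. (T ^^ (k + n)) v) \<longlonglongrightarrow> 0"
      using v by (rule LIMSEQ_ignore_initial_segment)
    then show ?thesis by (simp add: S_def funpow_add)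
  qed
  have half: "norm ((T ^^ (p + n)) v) \<le> 1/2 * norm ((T ^^ n) v)" for n
  proof -
    have "norm ((T ^^ p) ((T ^^ n) v)) \<le> norm ((T ^^ n) v) * (\<Sum>b\<in>B. norm ((T ^^ p) b))"
      by (rule B(3)[OF lin S_funpow])
    also have "\<dots> \<le> norm ((T ^^ n) v) * (1/2)"
      using N[of p] by (intro mult_left_mono) (auto simp: p_def)
    finally show ?thesis by (simp add: funpow_add)
  qed
  define s where "s n = (\<Sum>i<n. norm ((T ^^ i) v))" for n
  have s_mono: "s m \<le> s n" if "m \<le> n" for m n
    unfolding s_def using that by (intro sum_mono2) auto
  \<comment> \<open>Halving after \<open>p\<close> steps gives \<open>s n \<le> s (p + n) \<le> s p + s n / 2\<close>.\<close>
  have "s n \<le> 2 * s p" for n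
  proof -
    have "s n \<le> s (p + n)" by (rule s_mono) simp
    also have "s (p + n) = s p + (\<Sum>i<n. norm ((T ^^ (p + i)) v))"
      unfolding s_def by (induction n) (simp_all add: add.assoc)
    also have "(\<Sum>i<n. norm ((T ^^ (p + i)) v)) \<le> 1/2 * s n"
      unfolding s_def sum_distrib_left by (intro sum_mono half)
    finally show ?thesis by simp
  qed
  then show ?thesis
    unfolding s_def by (intro summableI_nonneg_bounded[where x = "2 * s p"]) (auto simp: s_def)
qed

text \<open>When all orbits in \<open>D\<close> are bounded, \<open>v\<close> splits into a part that is attracted to zero and a
  limit point \<open>c\<close> of its own orbit. To find \<open>c\<close>, let \<open>(T ^^ r k) v\<close> converge. Applying
  \<open>T ^^ r k\<close> to \<open>(T ^^ (r (2 * k) - r k)) v\<close> gives another element of this sequence, so a limit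
  point \<open>c\<close> of the vectors \<open>(T ^^ (r (2 * k) - r k)) v\<close> and \<open>v\<close> itself are asymptotic along a
  subsequence, hence, by boundedness, along all times.\<close>

lemma bounded_orbit_splitting:
  fixes T :: "'v::euclidean_space \<Rightarrow> 'v"
  assumes T: "linear T" and D: "subspace D" and inv: "\<And>x. x \<in> D \<Longrightarrow> T x \<in> D"
    and bdd: "\<And>x. x \<in> D \<Longrightarrow> bounded (range (\<lambda>n. (T ^^ n) x))" and v: "v \<in> D"
  obtains c m where "filterlim m at_top sequentially" "(\<lambda>j. (T ^^ m j) v) \<longlonglongrightarrow> c"
    "(\<lambda>n. (T ^^ n) (v - c)) \<longlonglongrightarrow> 0"
proof -
  have lin: "linear (T ^^ n)" for n by (rule linear_funpow[OF T])
  have D_funpow: "(T ^^ n) x \<in> D" if "x \<in> D" for n x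
    by (induction n) (simp_all add: that inv)
  obtain B where B: "finite B" "B \<subseteq> D"
    "\<And>(L :: 'v \<Rightarrow> 'v) x. linear L \<Longrightarrow> x \<in> D \<Longrightarrow> norm (L x) \<le> norm x * (\<Sum>b\<in>B. norm (L b))"
    using subspace_operator_norm_bound[OF D, where 'w='v] by metis
  have "\<exists>C. \<forall>n. norm ((T ^^ n) b) \<le> C" if "b \<in> B" for b
    using bdd[of b] that B(2) by (auto simp: bounded_iff)
  then obtain C where C: "\<And>b n. b \<in> B \<Longrightarrow> norm ((T ^^ n) b) \<le> C b" by metis
  define K where "K = (\<Sum>b\<in>B. C b)"
  have K: "norm ((T ^^ n) x) \<le> K * norm x" if "x \<in> D" for n x
  proof -
    have "norm ((T ^^ n) x) \<le> norm x * (\<Sum>b\<in>B. norm ((T ^^ n) b))"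
      by (rule B(3)[OF lin that])
    also have "\<dots> \<le> norm x * K"
      unfolding K_def by (intro mult_left_mono sum_mono C) auto
    finally show ?thesis by (simp add: mult.commute)
  qed
  have subseq: "\<exists>l r. strict_mono r \<and> (\<lambda>j. (T ^^ f (r j)) v) \<longlonglongrightarrow> l" for f :: "nat \<Rightarrow> nat"
  proof -
    have "bounded (range (\<lambda>j. (T ^^ f j) v))"
      by (rule bounded_subset[OF bdd[OF v]]) auto
    from bounded_imp_convergent_subsequence[OF this] show ?thesis
      by (auto simp: o_def)
  qed
  obtain q r where r: "strict_mono r" and q: "(\<lambda>k. (T ^^ r k) v) \<longlonglongrightarrow> q"
    using subseq[of "\<lambda>n. n"] by auto
  \<comment> \<open>Doubling the index makes the gaps \<open>d k\<close> at least \<open>k\<close>, so that \<open>c\<close> is a limit along times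
    that tend to infinity.\<close>
  define d where "d k = r (2 * k) - r k" for k
  have d_ge: "k \<le> d k" and r_double: "r k + d k = r (2 * k)" for k
  proof -
    have "r k + i \<le> r (k + i)" for i
    proof (induction i)
      case (Suc i)
      have "r (k + i) < r (k + Suc i)" using r by (simp add: strict_mono_def)
      with Suc.IH show ?case by simp
    qed simp
    from this[of k] show "k \<le> d k" "r k + d k = r (2 * k)" by (simp_all add: d_def mult_2)
  qed
  obtain c s where s: "strict_mono s" and c: "(\<lambda>j. (T ^^ d (s j)) v) \<longlonglongrightarrow> c"
    using subseq[of d] by auto
  have c_D: "c \<in> D"
    using closed_subspace[OF D] D_funpow[OF v] c by (metis closed_sequentially)
  have vc_D: "v - c \<in> D" using v c_D D by (simp add: subspace_diff)
  have dist_c: "(T ^^ d (s j)) v - c \<in> D" for j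
    using D_funpow[OF v] c_D D by (simp add: subspace_diff)
  have s_inf: "filterlim s at_top sequentially" by (rule filterlim_subseq[OF s])
  have q1: "(\<lambda>j. (T ^^ r (s j)) v) \<longlonglongrightarrow> q"
    by (rule filterlim_compose[OF q s_inf])
  have q2: "(\<lambda>j. (T ^^ r (2 * s j)) v) \<longlonglongrightarrow> q"
  proof (rule filterlim_compose[OF q])
    show "filterlim (\<lambda>j. 2 * s j) at_top sequentially"
      by (rule filterlim_at_top_mono[OF s_inf]) simp
  qed
  have small: "(\<lambda>j. (T ^^ r (s j)) ((T ^^ d (s j)) v - c)) \<longlonglongrightarrow> 0"
  proof (rule Lim_null_comparison)
    show "\<forall>\<^sub>F j in sequentially. norm ((T ^^ r (s j)) ((T ^^ d (s j)) v - c))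
        \<le> K * norm ((T ^^ d (s j)) v - c)"
      using K[OF dist_c] by simp
    have "(\<lambda>j. (T ^^ d (s j)) v - c) \<longlonglongrightarrow> 0" using c by (simp add: LIM_zero)
    from tendsto_mult[OF tendsto_const[of K] tendsto_norm_zero[OF this]]
    show "(\<lambda>j. K * norm ((T ^^ d (s j)) v - c)) \<longlonglongrightarrow> 0" by simp
  qed
  have split: "(T ^^ r (s j)) (v - c) =
      (T ^^ r (s j)) v - (T ^^ r (2 * s j)) v + (T ^^ r (s j)) ((T ^^ d (s j)) v - c)" for j
    by (simp add: linear_diff[OF lin] r_double[symmetric] funpow_add)
  have sub0: "(\<lambda>j. (T ^^ r (s j)) (v - c)) \<longlonglongrightarrow> 0"
    unfolding split using tendsto_add[OF tendsto_diff[OF q1 q2] small] by simp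
  have "(\<lambda>n. (T ^^ n) (v - c)) \<longlonglongrightarrow> 0"
  proof (rule LIMSEQ_I)
    fix e :: real assume e: "0 < e"
    have "(\<lambda>j. K * norm ((T ^^ r (s j)) (v - c))) \<longlonglongrightarrow> K * 0"
      by (intro tendsto_mult tendsto_const tendsto_norm_zero sub0)
    then have "\<forall>\<^sub>F j in sequentially. K * norm ((T ^^ r (s j)) (v - c)) < e"
      using e by (intro order_tendstoD) simp_all
    then obtain j where j: "K * norm ((T ^^ r (s j)) (v - c)) < e"
      by (auto simp: eventually_sequentially)
    show "\<exists>no. \<forall>n\<ge>no. norm ((T ^^ n) (v - c) - 0) < e"
    proof (intro exI allI impI)
      fix n assume "r (s j) \<le> n"
      then obtain i where "n = i + r (s j)" by (metis le_add_diff_inverse2)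
      then show "norm ((T ^^ n) (v - c) - 0) < e"
        using K[OF D_funpow[OF vc_D], of i "r (s j)"] j by (simp add: funpow_add)
    qed
  qed
  moreover have "filterlim (\<lambda>j. d (s j)) at_top sequentially"
    by (rule filterlim_at_top_mono[OF s_inf]) (simp add: d_ge)
  ultimately show thesis using c that by metis
qed


section \<open>Quasi-additive sequences\<close>

text \<open>The sequence \<open>s n + C\<close> is subadditive and \<open>s n - C\<close> is superadditive; comparing both
  at \<open>m * n\<close> shows that every slope \<open>(s m - C) / m\<close> is at most every slope \<open>(s n + C) / n\<close>, and
  any number in between serves as \<open>f\<close>.\<close>

lemma quasi_additive_near_linear:
  fixes s :: "nat \<Rightarrow> real"
  assumes s: "\<And>m n. \<bar>s (m + n) - s m - s n\<bar> \<le> C"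
  obtains f where "\<And>n. \<bar>s n - f * real n\<bar> \<le> C"
proof -
  have mult: "\<bar>s (Suc k * n) - real (Suc k) * s n\<bar> \<le> real k * C" for k n
  proof (induction k)
    case 0
    then show ?case by simp
  next
    case (Suc k)
    have "s (Suc (Suc k) * n) - real (Suc (Suc k)) * s n =
        (s (n + Suc k * n) - s n - s (Suc k * n)) + (s (Suc k * n) - real (Suc k) * s n)"
      by (simp add: algebra_simps)
    then show ?case using s[of n "Suc k * n"] Suc.IH by (simp add: algebra_simps)
  qed
  have C0: "0 \<le> C" using s[of 0 0] by linarith
  have mult': "\<bar>s (m * n) - real m * s n\<bar> \<le> (real m - 1) * C" if "m \<ge> 1" for m n
    using mult[of "m - 1" n] that by (simp add: of_nat_diff)
  have slopes: "(s m - C) / real m \<le> (s n + C) / real n" if "m \<ge> 1" "n \<ge> 1" for m n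
  proof -
    have "real n * (s m - C) \<le> s (m * n)"
      using mult'[of n m] that C0 by (simp add: algebra_simps abs_le_iff)
    moreover have "s (m * n) \<le> real m * (s n + C)"
      using mult'[of m n] that C0 by (simp add: algebra_simps abs_le_iff)
    ultimately show ?thesis using that by (simp add: field_simps)
  qed
  define f where "f = (SUP m\<in>{1..}. (s m - C) / real m)"
  have bdd: "bdd_above ((\<lambda>m. (s m - C) / real m) ` {1..})"
    using slopes[of _ 1] by (intro bdd_aboveI[where M = "(s 1 + C) / real 1"]) auto
  have "\<bar>s n - f * real n\<bar> \<le> C" for n
  proof (cases "n = 0")
    case True
    then show ?thesis using s[of 0 0] by simp
  next
    case False
    have "(s n - C) / real n \<le> f"
      unfolding f_def using False by (intro cSUP_upper bdd) simp
    moreover have "f \<le> (s n + C) / real n"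
      unfolding f_def using False slopes by (intro cSUP_least) auto
    ultimately show ?thesis
      using False by (auto simp: field_simps abs_le_iff)
  qed
  then show thesis by (rule that)
qed


section \<open>Weights of words\<close>

definition weight :: "real^'a \<Rightarrow> 'a::finite list \<Rightarrow> real" where
  "weight v w = (\<Sum>a\<leftarrow>w. v $ a)"

lemma weight_simps [simp]:
  "weight v [] = 0"
  "weight v (a # w) = v $ a + weight v w"
  "weight v (u @ w) = weight v u + weight v w"
  by (simp_all add: weight_def)

lemma weight_linear:
  "weight 0 w = 0"
  "weight (u + v) w = weight u w + weight v w"
  "weight (u - v) w = weight u w - weight v w"
  "weight (- v) w = - weight v w"
  "weight (r *\<^sub>R v) w = r * weight v w"
  by (induction w) (simp_all add: algebra_simps)

lemma weight_one: "weight 1 w = real (length w)"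
  by (induction w) simp_all

lemma weight_axis: "weight (axis a 1) w = real (count_list w a)"
  by (induction w) (simp_all add: axis_def)

lemma abs_weight_le: "\<bar>weight v w\<bar> \<le> real (length w) * norm v"
proof (induction w)
  case (Cons a w)
  then show ?case using component_le_norm_cart[of v a] by (simp add: algebra_simps)
qed simp

lemma tendsto_weight: "(f \<longlongrightarrow> v) F \<Longrightarrow> ((\<lambda>x. weight (f x) w) \<longlongrightarrow> weight v w) F"
  by (induction w) (auto intro!: tendsto_intros)

lemma norm_le_weights: "norm v \<le> (\<Sum>a\<in>UNIV. \<bar>weight v [a]\<bar>)"
  using norm_le_l1_cart[of v] by simp

lemma weight_eq_sum_count: "weight v w = (\<Sum>b\<in>UNIV. v $ b * real (count_list w b))"
proof (induction w)
  case (Cons a w)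
  have "(\<Sum>b\<in>UNIV. v $ b * real (count_list (a # w) b)) =
      (\<Sum>b\<in>UNIV. (if a = b then v $ b else 0) + v $ b * real (count_list w b))"
    by (intro sum.cong) (auto simp: algebra_simps)
  then show ?case using Cons by (simp add: sum.distrib)
qed simp

definition bounded_weights :: "'a::finite list set \<Rightarrow> (real^'a) set" where
  "bounded_weights L = {v. \<exists>K. \<forall>w\<in>L. \<bar>weight v w\<bar> \<le> K}"

lemma bounded_weightsI: "(\<And>w. w \<in> L \<Longrightarrow> \<bar>weight v w\<bar> \<le> K) \<Longrightarrow> v \<in> bounded_weights L"
  by (auto simp: bounded_weights_def)

lemma bounded_weightsE:
  assumes "v \<in> bounded_weights L"
  obtains K where "\<And>w. w \<in> L \<Longrightarrow> \<bar>weight v w\<bar> \<le> K"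
  using assms by (auto simp: bounded_weights_def)

lemma subspace_bounded_weights: "subspace (bounded_weights L)"
proof (rule subspaceI)
  show "0 \<in> bounded_weights L"
    by (rule bounded_weightsI[of _ _ 0]) (simp add: weight_linear)
next
  fix x y assume "x \<in> bounded_weights L" "y \<in> bounded_weights L"
  then obtain K1 K2 where "\<And>w. w \<in> L \<Longrightarrow> \<bar>weight x w\<bar> \<le> K1" "\<And>w. w \<in> L \<Longrightarrow> \<bar>weight y w\<bar> \<le> K2"
    by (auto elim!: bounded_weightsE)
  then show "x + y \<in> bounded_weights L"
    by (intro bounded_weightsI[of _ _ "K1 + K2"]) (fastforce simp: weight_linear)
next
  fix r x assume "x \<in> bounded_weights L"
  then obtain K where "\<And>w. w \<in> L \<Longrightarrow> \<bar>weight x w\<bar> \<le> K" by (auto elim!: bounded_weightsE)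
  then show "r *\<^sub>R x \<in> bounded_weights L"
    by (intro bounded_weightsI[of _ _ "\<bar>r\<bar> * K"]) (simp add: weight_linear abs_mult mult_left_mono)
qed


section \<open>Languages of subshifts\<close>

lemma length_factor [simp]: "length (factor x i n) = n"
  by (simp add: factor_def)

lemma factor_add: "factor x i (m + n) = factor x i m @ factor x (i + int m) n"
  by (rule nth_equalityI) (auto simp: factor_def nth_append add.assoc[symmetric])

lemma language_sublist:
  assumes "w \<in> language X" "sublist u w"
  shows "u \<in> language X"
proof -
  obtain x i n p s where x: "x \<in> X" "w = factor x i n" and w: "w = p @ u @ s"
    using assms by (auto simp: language_def sublist_def)
  have n: "n = length p + (length u + length s)" using x(2) w by (metis length_factor length_append)
  have "p @ u @ s = factor x i (length p) @ factor x (i + int (length p)) (length u) @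
      factor x (i + int (length p) + int (length u)) (length s)"
    using x(2) w by (simp only: n factor_add)
  then have "u = factor x (i + int (length p)) (length u)"
    by (metis append_eq_append_conv length_factor)
  then show ?thesis using x(1) by (auto simp: language_def)
qed

text \<open>Balance says that the number of occurrences of \<open>a\<close> along a point of the subshift is
  quasi-additive, so it stays close to \<open>f\<close> times the length for a frequency \<open>f\<close>. Thus each
  \<open>axis a 1\<close> has bounded weights up to a multiple of the constant vector \<open>1\<close>, whose weights, the
  lengths, are unbounded. Hence the constants are a complement of the bounded weights exactly in the
  balanced case.\<close>

lemma letter_balanced_iff_codim_bounded_weights:
  fixes X :: "(int \<Rightarrow> 'a::finite) set"
  assumes "X \<noteq> {}"
  shows "letter_balanced X \<longleftrightarrow> codim (bounded_weights (language X)) = 1"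
proof -
  let ?D = "bounded_weights (language X)"
  obtain x where x: "x \<in> X" using assms by blast
  have factor_lang: "factor x i n \<in> language X" for i n
    using x by (auto simp: language_def)
  have one: "1 \<notin> ?D"
  proof
    assume "1 \<in> ?D"
    then obtain K where K: "\<And>w. w \<in> language X \<Longrightarrow> \<bar>weight 1 w\<bar> \<le> K"
      unfolding bounded_weights_def by blast
    obtain n where "real n > K" using reals_Archimedean2 by blast
    with K[OF factor_lang[of 0 n]] show False by (simp add: weight_one)
  qed
  have span_D: "span ?D = ?D" by (rule span_eq_iff[THEN iffD2, OF subspace_bounded_weights])
  have dim_1: "dim (insert 1 ?D) = dim ?D + 1"
    using one by (simp add: dim_insert span_D)
  have codim: "codim ?D = 1 \<longleftrightarrow> span (insert 1 ?D) = UNIV"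
    unfolding dim_eq_full[symmetric] dim_1 by (simp add: codim_def) arith
  have "span (insert 1 ?D) = UNIV \<longleftrightarrow> (\<forall>a. axis a 1 \<in> span (insert 1 ?D))"
  proof (intro iffI allI)
    assume ax: "\<forall>a. axis a 1 \<in> span (insert 1 ?D)"
    have "Basis \<subseteq> span (insert 1 ?D)"
      using ax by (auto simp: Basis_vec_def)
    then have "span Basis \<subseteq> span (insert 1 ?D)" by (rule span_minimal) (rule subspace_span)
    then show "span (insert 1 ?D) = UNIV" by auto
  qed simp
  also have "\<dots> \<longleftrightarrow> (\<forall>a. \<exists>f. axis a 1 - f *\<^sub>R 1 \<in> ?D)"
    unfolding span_breakdown_eq span_D ..
  also have "\<dots> \<longleftrightarrow> letter_balanced X"
  proof (intro iffI allI)
    assume D: "\<forall>a. \<exists>f. axis a 1 - f *\<^sub>R 1 \<in> ?D"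
    show "letter_balanced X"
      unfolding letter_balanced_def
    proof
      fix a
      obtain f K where K: "\<And>w. w \<in> language X \<Longrightarrow> \<bar>weight (axis a 1 - f *\<^sub>R 1) w\<bar> \<le> K"
        using D by (meson bounded_weightsE)
      show "\<exists>C::real. \<forall>w\<in>language X. \<forall>w'\<in>language X. length w = length w' \<longrightarrow>
          \<bar>real (count_list w a) - real (count_list w' a)\<bar> \<le> C"
      proof (intro exI ballI impI)
        fix w w' :: "'a list" assume "w \<in> language X" "w' \<in> language X" "length w = length w'"
        then show "\<bar>real (count_list w a) - real (count_list w' a)\<bar> \<le> 2 * K"
          using K[of w] K[of w'] by (simp add: weight_linear weight_axis weight_one)
      qed
    qed
  next
    fix a assume "letter_balanced X"
    then obtain C where C: "\<And>w w'. w \<in> language X \<Longrightarrow> w' \<in> language X \<Longrightarrow> length w = length w' \<Longrightarrow>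
        \<bar>real (count_list w a) - real (count_list w' a)\<bar> \<le> C"
      unfolding letter_balanced_def by metis
    define s where "s n = real (count_list (factor x 0 n) a)" for n
    have "\<bar>s (m + n) - s m - s n\<bar> \<le> C" for m n
      using C[OF factor_lang[of "int m" n] factor_lang[of 0 n]]
      by (simp add: s_def factor_add)
    then obtain f where f: "\<And>n. \<bar>s n - f * real n\<bar> \<le> C"
      using quasi_additive_near_linear by metis
    have "axis a 1 - f *\<^sub>R 1 \<in> ?D"
    proof (rule bounded_weightsI)
      fix w assume "w \<in> language X"
      then show "\<bar>weight (axis a 1 - f *\<^sub>R 1) w\<bar> \<le> 2 * C"
        using C[OF _ factor_lang[of 0 "length w"], of w] f[of "length w"]
        by (simp add: weight_linear weight_axis weight_one s_def)
    qed
    then show "\<exists>f. axis a 1 - f *\<^sub>R 1 \<in> ?D" by blast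
  qed
  finally show ?thesis using codim by simp
qed


section \<open>Letter-coboundaries\<close>

text \<open>A morphism to the reals is determined by its values on letters, so the morphisms in the
  definition of the coboundary space are the functions \<open>weight v\<close>.\<close>

lemma coboundary_space_iff:
  "v \<in> coboundary_space X \<longleftrightarrow> (\<forall>a w. return_word X a w \<longrightarrow> weight v w = 0)"
proof
  assume "v \<in> coboundary_space X"
  then obtain c where v: "v = (\<chi> a. c [a])" and c: "letter_coboundary X c"
    by (auto simp: coboundary_space_def)
  have app: "c (u @ w) = c u + c w" for u w using c by (simp add: letter_coboundary_def)
  have "c w = weight v w" for w
  proof (induction w)
    case Nil
    show ?case using app[of "[]" "[]"] by simp
  next
    case (Cons a w)
    then show ?case using app[of "[a]" w] by (simp add: v)
  qed
  then show "\<forall>a w. return_word X a w \<longrightarrow> weight v w = 0"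
    using c by (simp add: letter_coboundary_def)
next
  assume "\<forall>a w. return_word X a w \<longrightarrow> weight v w = 0"
  then have "letter_coboundary X (weight v)" by (simp add: letter_coboundary_def)
  moreover have "v = (\<chi> a. weight v [a])" by (simp add: vec_eq_iff)
  ultimately show "v \<in> coboundary_space X" unfolding coboundary_space_def by blast
qed

text \<open>Cutting a word between two occurrences of \<open>a\<close> before each occurrence of \<open>a\<close> in between
  decomposes it into return words.\<close>

lemma coboundary_weight_zero:
  assumes v: "v \<in> coboundary_space X"
  shows "w @ [a] \<in> language X \<Longrightarrow> w = [] \<or> hd w = a \<Longrightarrow> weight v w = 0"
proof (induction w rule: length_induct)
  case (1 w)
  show ?case
  proof (cases w)
    case Nil
    then show ?thesis by simp
  next
    case (Cons b w')
    with 1(3) have w: "w = a # w'" by simp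
    obtain p q where pq: "w' @ [a] = p @ a # q" and p: "a \<notin> set p"
      using split_list_first[of a "w' @ [a]"] by auto
    define r where "r = butlast (a # q)"
    have r: "a # q = r @ [a]"
      using arg_cong[OF pq, of last] unfolding r_def
      by (metis append_butlast_last_id last_appendR last_snoc list.distinct(1))
    have wr: "w = (a # p) @ r" using pq r w by (metis append.assoc append_Cons append_same_eq)
    have "w @ [a] = (a # p @ [a]) @ q" "w @ [a] = (a # p) @ (r @ [a])"
      using r by (simp_all add: wr flip: r)
    then have "sublist (a # p @ [a]) (w @ [a])" "sublist (r @ [a]) (w @ [a])"
      by (metis sublist_append_rightI, metis sublist_append_leftI)
    then have "a # p @ [a] \<in> language X" and rX: "r @ [a] \<in> language X"
      using 1(2) language_sublist by blast+
    then have "return_word X a (a # p)"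
      using p by (simp add: return_word_def suffix_def)
    then have "weight v (a # p) = 0" using v unfolding coboundary_space_iff by blast
    moreover have "weight v r = 0"
    proof -
      have "length r < length w" by (simp add: wr)
      moreover have "r = [] \<or> hd r = a" using r by (cases r) auto
      ultimately show ?thesis using 1(1) rX by blast
    qed
    ultimately show ?thesis by (simp add: wr)
  qed
qed

text \<open>The part of a word before the last occurrence of its first letter has weight zero, and the part
  after this occurrence no longer contains that letter.\<close>

lemma abs_coboundary_weight_le:
  assumes v: "v \<in> coboundary_space X"
  shows "w \<in> language X \<Longrightarrow> \<bar>weight v w\<bar> \<le> (\<Sum>a\<in>set w. \<bar>v $ a\<bar>)"
proof (induction w rule: length_induct)
  case (1 w)
  show ?case
  proof (cases w)
    case Nil
    then show ?thesis by simp
  next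
    case (Cons a w')
    obtain p q where pq: "w = p @ a # q" and q: "a \<notin> set q"
      using split_list_last[of a w] Cons by auto
    have "w = (p @ [a]) @ q" using pq by simp
    then have "sublist (p @ [a]) w" "sublist q w"
      by (metis sublist_append_rightI, metis sublist_append_leftI)
    then have "p @ [a] \<in> language X" "q \<in> language X"
      using language_sublist[OF 1(2)] by blast+
    moreover have "p = [] \<or> hd p = a" using Cons pq by (cases p) auto
    ultimately have p0: "weight v p = 0" and q0: "\<bar>weight v q\<bar> \<le> (\<Sum>a\<in>set q. \<bar>v $ a\<bar>)"
      using coboundary_weight_zero[OF v] 1(1) by (auto simp: pq)
    have "\<bar>weight v w\<bar> \<le> (\<Sum>b\<in>insert a (set q). \<bar>v $ b\<bar>)"
      using p0 q0 q by (simp add: pq)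
    also have "\<dots> \<le> (\<Sum>b\<in>set w. \<bar>v $ b\<bar>)" by (intro sum_mono2) (auto simp: pq)
    finally show ?thesis .
  qed
qed

lemma coboundary_space_subset_bounded_weights:
  "coboundary_space X \<subseteq> bounded_weights (language X)"
proof
  fix v assume v: "v \<in> coboundary_space X"
  show "v \<in> bounded_weights (language X)"
  proof (rule bounded_weightsI)
    fix w assume "w \<in> language X"
    then have "\<bar>weight v w\<bar> \<le> (\<Sum>a\<in>set w. \<bar>v $ a\<bar>)" by (rule abs_coboundary_weight_le[OF v])
    also have "\<dots> \<le> (\<Sum>a\<in>UNIV. \<bar>v $ a\<bar>)" by (intro sum_mono2) auto
    finally show "\<bar>weight v w\<bar> \<le> (\<Sum>a\<in>UNIV. \<bar>v $ a\<bar>)" .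
  qed
qed


section \<open>Primitive substitutions\<close>

definition substitution_words :: "('a list \<Rightarrow> 'a list) \<Rightarrow> 'a list set" where
  "substitution_words \<tau> = {w. \<exists>k\<ge>1. \<exists>a. sublist w ((\<tau> ^^ k) [a])}"

locale primitive_substitution =
  fixes \<tau> :: "'a::finite list \<Rightarrow> 'a list"
  assumes two_letters: "CARD('a) \<ge> 2"
    and substitution: "substitution \<tau>"
    and primitive: "primitive \<tau>"
begin

abbreviation "X \<equiv> subst_shift \<tau>"
abbreviation "D \<equiv> bounded_weights (language X)"

lemma image_append: "\<tau> (u @ w) = \<tau> u @ \<tau> w"
  using substitution by (simp add: substitution_def)

lemma image_Nil [simp]: "\<tau> [] = []"
  using image_append[of "[]" "[]"] by simp

lemma image_Cons: "\<tau> (a # w) = \<tau> [a] @ \<tau> w"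
  using image_append[of "[a]" w] by simp

lemma funpow_append: "(\<tau> ^^ n) (u @ w) = (\<tau> ^^ n) u @ (\<tau> ^^ n) w"
  by (induction n) (simp_all add: image_append)

lemma funpow_sublist:
  assumes "sublist u w"
  shows "sublist ((\<tau> ^^ n) u) ((\<tau> ^^ n) w)"
proof -
  obtain p s where "w = p @ u @ s" using assms by (auto simp: sublist_def)
  then show ?thesis by (simp add: funpow_append)
qed


subsection \<open>The action of the incidence matrix\<close>

definition T :: "real^'a \<Rightarrow> real^'a" where
  "T v = v v* incidence_matrix \<tau>"

lemma linear_T: "linear T"
  by (rule linearI) (simp_all add: T_def vector_matrix_left_distrib scaleR_vector_matrix_assoc)

lemma funpow_T: "(T ^^ n) v = v v* matrix_power (incidence_matrix \<tau>) n"
  by (induction n) (simp_all add: T_def vector_matrix_mul_assoc)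

lemma weight_T: "weight (T v) w = weight v (\<tau> w)"
proof (induction w)
  case (Cons a w)
  have "T v $ a = weight v (\<tau> [a])"
    by (simp add: T_def vector_matrix_mult_def incidence_matrix_def weight_eq_sum_count)
  then show ?case using Cons by (simp add: image_Cons[of a w])
qed simp

lemma weight_funpow_T: "weight ((T ^^ n) v) w = weight v ((\<tau> ^^ n) w)"
  by (induction n arbitrary: w) (simp_all add: weight_T funpow_swap1[of \<tau>])

lemma stable_space_iff: "v \<in> stable_space \<tau> \<longleftrightarrow> (\<lambda>n. (T ^^ n) v) \<longlonglongrightarrow> 0"
  by (simp add: stable_space_def funpow_T)

lemma incidence_matrix_power:
  "matrix_power (incidence_matrix \<tau>) n $ b $ a = real (count_list ((\<tau> ^^ n) [a]) b)"
proof -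
  have "weight ((T ^^ n) (axis b 1)) [a] = matrix_power (incidence_matrix \<tau>) n $ b $ a"
    by (simp add: funpow_T vector_matrix_mult_def axis_def if_distrib[of "\<lambda>x. x * _"] cong: if_cong)
  then show ?thesis by (simp add: weight_funpow_T weight_axis del: weight_simps)
qed

text \<open>Positivity of one power of the incidence matrix persists for all larger powers, because
  every letter occurs in the image of some letter.\<close>

lemma letter_occurs_eventually: "\<exists>N. \<forall>n\<ge>N. \<forall>a b. b \<in> set ((\<tau> ^^ n) [a])"
proof -
  obtain N where N: "\<And>b a. matrix_power (incidence_matrix \<tau>) N $ b $ a > 0"
    using primitive by (auto simp: primitive_def)
  have "b \<in> set ((\<tau> ^^ n) [a])" if "n \<ge> N" for n a b
    using that
  proof (induction n arbitrary: b rule: dec_induct)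
    case base
    show ?case using N[of b a] by (metis count_list_0_iff incidence_matrix_power less_irrefl of_nat_0)
  next
    case (step n)
    obtain c where c: "b \<in> set (\<tau> [c])" using substitution unfolding substitution_def by blast
    obtain p s where "(\<tau> ^^ n) [a] = p @ [c] @ s"
      using split_list[OF step.IH[of c]] by auto
    then have "(\<tau> ^^ Suc n) [a] = \<tau> p @ \<tau> [c] @ \<tau> s" by (simp only: funpow.simps o_apply image_append)
    then show ?case using c by simp
  qed
  then show ?thesis by blast
qed

lemma word_occurs_eventually:
  assumes "w \<in> substitution_words \<tau>"
  shows "\<exists>N. \<forall>n\<ge>N. \<forall>a. sublist w ((\<tau> ^^ n) [a])"
proof -
  obtain k b where k: "sublist w ((\<tau> ^^ k) [b])"
    using assms by (auto simp: substitution_words_def)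
  obtain N where N: "\<And>n a b. n \<ge> N \<Longrightarrow> b \<in> set ((\<tau> ^^ n) [a])"
    using letter_occurs_eventually by blast
  have "sublist w ((\<tau> ^^ n) [a])" if "n \<ge> k + N" for n a
  proof -
    define m where "m = n - k"
    have n: "n = k + m" and m: "m \<ge> N" using that by (auto simp: m_def)
    have "sublist [b] ((\<tau> ^^ m) [a])"
      using split_list[OF N[OF m, of b a]] by (auto simp: sublist_def)
    from funpow_sublist[OF this, of k] k show ?thesis
      by (auto simp: n funpow_add intro: sublist_order.order.trans)
  qed
  then show ?thesis by blast
qed


subsection \<open>Words of the language are the factors of iterated images of letters\<close>

text \<open>Some iterated image of a letter contains two adjacent letters. A word occurs in a common
  iterated image of both, and the other one supplies the extension to the right or to the left.\<close>

lemma substitution_words_extend: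
  assumes "w \<in> substitution_words \<tau>"
  shows "\<exists>y. w @ [y] \<in> substitution_words \<tau>" "\<exists>y. y # w \<in> substitution_words \<tau>"
proof -
  obtain N where N: "\<And>n a b. n \<ge> N \<Longrightarrow> b \<in> set ((\<tau> ^^ n) [a])"
    using letter_occurs_eventually by blast
  obtain N' where N': "\<And>n a. n \<ge> N' \<Longrightarrow> sublist w ((\<tau> ^^ n) [a])"
    using word_occurs_eventually[OF assms] by blast
  define n where "n = Suc (max N N')"
  have n: "n \<ge> N" "n \<ge> N'" "n + N \<ge> 1" by (auto simp: n_def)
  obtain a :: 'a where True by blast
  have "set ((\<tau> ^^ N) [a]) = UNIV" using N[of N] by auto
  then have "length ((\<tau> ^^ N) [a]) \<ge> 2"
    using two_letters card_length[of "(\<tau> ^^ N) [a]"] by simp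
  then obtain d e r where de: "(\<tau> ^^ N) [a] = [d] @ [e] @ r"
    by (auto simp: numeral_2_eq_2 Suc_le_length_iff)
  have img: "(\<tau> ^^ (n + N)) [a] = (\<tau> ^^ n) [d] @ (\<tau> ^^ n) [e] @ (\<tau> ^^ n) r"
    by (simp only: funpow_add o_apply de funpow_append)
  have ne: "(\<tau> ^^ n) [c] \<noteq> []" for c using N[OF n(1), of c c] by auto
  obtain p s where d: "(\<tau> ^^ n) [d] = p @ w @ s" using N'[OF n(2), of d] by (auto simp: sublist_def)
  obtain p' s' where e: "(\<tau> ^^ n) [e] = p' @ w @ s'" using N'[OF n(2), of e] by (auto simp: sublist_def)
  have sub: "u \<in> substitution_words \<tau>" if "sublist u ((\<tau> ^^ (n + N)) [a])" for u
    using that n(3) by (auto simp: substitution_words_def)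
  obtain y z where y: "s @ (\<tau> ^^ n) [e] = y # z" using ne[of e] by (cases "s @ (\<tau> ^^ n) [e]") auto
  have "(\<tau> ^^ (n + N)) [a] = p @ (w @ [y]) @ (z @ (\<tau> ^^ n) r)"
    unfolding img d using y by simp
  then have "w @ [y] \<in> substitution_words \<tau>" by (intro sub) (metis sublist_appendI)
  then show "\<exists>y. w @ [y] \<in> substitution_words \<tau>" ..
  obtain y z where y: "(\<tau> ^^ n) [d] @ p' = z @ [y]"
    using ne[of d] by (cases "(\<tau> ^^ n) [d] @ p'" rule: rev_cases) auto
  have "(\<tau> ^^ (n + N)) [a] = ((\<tau> ^^ n) [d] @ p') @ w @ s' @ (\<tau> ^^ n) r"
    unfolding img e by simp
  then have "(\<tau> ^^ (n + N)) [a] = z @ (y # w) @ (s' @ (\<tau> ^^ n) r)"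
    unfolding y by simp
  then have "y # w \<in> substitution_words \<tau>" by (intro sub) (metis sublist_appendI)
  then show "\<exists>y. y # w \<in> substitution_words \<tau>" ..
qed

lemma substitution_words_sublist:
  "w \<in> substitution_words \<tau> \<Longrightarrow> sublist u w \<Longrightarrow> u \<in> substitution_words \<tau>"
  unfolding substitution_words_def using sublist_order.order.trans by blast

text \<open>Extending a word by one letter on each side again and again gives a nested sequence whose
  union is a point of the subshift.\<close>

lemma language_subst_shift: "language X = substitution_words \<tau>"
proof
  show "language X \<subseteq> substitution_words \<tau>"
    by (auto simp: language_def subst_shift_def substitution_words_def)
next
  show "substitution_words \<tau> \<subseteq> language X"
  proof
    fix w assume w: "w \<in> substitution_words \<tau>"
    have step: "\<exists>u'. u' \<in> substitution_words \<tau> \<and> (\<exists>y z. u' = y # u @ [z])"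
      if "u \<in> substitution_words \<tau>" for u
      using that substitution_words_extend by (metis append_Cons)
    have "\<exists>W. \<forall>n. (W n \<in> substitution_words \<tau> \<and> (n = 0 \<longrightarrow> W n = w)) \<and>
        (\<exists>y z. W (Suc n) = y # W n @ [z])"
      by (rule dependent_nat_choice) (use w step in \<open>auto\<close>)
    then obtain W where W: "\<And>n. W n \<in> substitution_words \<tau>" "W 0 = w"
      and W_Suc: "\<And>n. \<exists>y z. W (Suc n) = y # W n @ [z]" by metis
    have len: "length (W n) = length w + 2 * n" for n
    proof (induction n)
      case (Suc n)
      then show ?case using W_Suc[of n] by auto
    qed (simp add: W)
    have W_shift: "W (n + m) ! (i + m) = W n ! i" if "i < length (W n)" for n m i
    proof (induction m)
      case (Suc m)
      obtain y z where "W (Suc (n + m)) = y # W (n + m) @ [z]" using W_Suc by blast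
      then show ?case using Suc.IH that by (simp add: nth_append len)
    qed simp
    \<comment> \<open>The word \<open>w\<close> sits in \<open>W n\<close> at position \<open>n\<close>, which is the origin of the point.\<close>
    define x where "x i = W (nat \<bar>i\<bar> + 1) ! nat (i + int (nat \<bar>i\<bar> + 1))" for i
    have x: "x i = W n ! nat (i + int n)" if "n \<ge> nat \<bar>i\<bar> + 1" for i n
    proof -
      define k where "k = nat \<bar>i\<bar> + 1"
      define m where "m = n - k"
      have k: "\<bar>i\<bar> < int k" and n: "n = k + m" using that by (simp_all add: k_def m_def)
      have idx: "nat (i + int k) + m = nat (i + int n)" using k by (simp add: n)
      have "nat (i + int k) < length (W k)" using k by (simp add: len)
      from W_shift[OF this, of m] show ?thesis
        unfolding x_def k_def[symmetric] idx n by simp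
    qed
    have "x \<in> X"
      unfolding subst_shift_def
    proof (intro CollectI allI)
      fix i m
      define n where "n = nat \<bar>i\<bar> + m + 1"
      have "factor x i m = take m (drop (nat (i + int n)) (W n))"
      proof (rule nth_equalityI)
        have "\<bar>i\<bar> + int m \<le> int n" by (simp add: n_def)
        then have "nat (i + int n) + m \<le> length (W n)" unfolding len by arith
        then show "length (factor x i m) = length (take m (drop (nat (i + int n)) (W n)))"
          by simp
        fix j assume "j < length (factor x i m)"
        then have j: "j < m" by simp
        have "x (i + int j) = W n ! nat (i + int j + int n)"
          by (rule x) (use j in \<open>simp add: n_def\<close>)
        also have "nat (i + int j + int n) = nat (i + int n) + j" by (simp add: n_def)
        finally show "factor x i m ! j = take m (drop (nat (i + int n)) (W n)) ! j"
          using j \<open>nat (i + int n) + m \<le> length (W n)\<close> by (simp add: factor_def)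
      qed
      then have "sublist (factor x i m) (W n)"
        by (metis sublist_take sublist_drop sublist_order.order.trans)
      then have "factor x i m \<in> substitution_words \<tau>"
        using substitution_words_sublist W(1) by blast
      then show "\<exists>k\<ge>1. \<exists>a. sublist (factor x i m) ((\<tau> ^^ k) [a])"
        by (simp add: substitution_words_def)
    qed
    moreover have "w = factor x 0 (length w)"
    proof (rule nth_equalityI)
      fix j assume j: "j < length w"
      have "x (int j) = W (Suc j) ! nat (int j + int (Suc j))" by (rule x) simp
      also have "nat (int j + int (Suc j)) = j + Suc j" by simp
      also have "W (Suc j) ! (j + Suc j) = w ! j"
        using W_shift[of j 0 "Suc j"] j by (simp add: W)
      finally show "w ! j = factor x 0 (length w) ! j" using j by (simp add: factor_def)
    qed simp
    ultimately show "w \<in> language X" unfolding language_def by blast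
  qed
qed

lemma letter_in_language: "[a] \<in> language X"
proof -
  obtain N where N: "\<And>n a b. n \<ge> N \<Longrightarrow> b \<in> set ((\<tau> ^^ n) [a])"
    using letter_occurs_eventually by blast
  have "a \<in> set ((\<tau> ^^ Suc N) [a])" by (rule N) simp
  then have "sublist [a] ((\<tau> ^^ Suc N) [a])" by (auto dest!: split_list simp: sublist_def)
  then show ?thesis unfolding language_subst_shift substitution_words_def
    by (intro CollectI exI[of _ "Suc N"]) auto
qed

lemma image_in_language:
  assumes "w \<in> language X"
  shows "(\<tau> ^^ n) w \<in> language X"
proof -
  obtain k a where "k \<ge> 1" "sublist w ((\<tau> ^^ k) [a])"
    using assms by (auto simp: language_subst_shift substitution_words_def)
  then have "n + k \<ge> 1" "sublist ((\<tau> ^^ n) w) ((\<tau> ^^ (n + k)) [a])"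
    by (auto simp: funpow_add intro: funpow_sublist)
  then show ?thesis unfolding language_subst_shift substitution_words_def by blast
qed

lemma subst_shift_nonempty: "X \<noteq> {}"
  using letter_in_language by (auto simp: language_def)


subsection \<open>Stable vectors have bounded weights\<close>

lemma prefix_of_image:
  assumes "prefix w (\<tau> u)" and l: "\<And>a. length (\<tau> [a]) \<le> l"
  shows "\<exists>w' p. w = \<tau> w' @ p \<and> prefix w' u \<and> length p \<le> l"
  using assms(1)
proof (induction u arbitrary: w)
  case Nil
  then show ?case by auto
next
  case (Cons a u)
  have "prefix w (\<tau> [a] @ \<tau> u)" using Cons.prems by (simp add: image_Cons[of a u])
  then consider "prefix w (\<tau> [a])" | w2 where "w = \<tau> [a] @ w2" "prefix w2 (\<tau> u)"
    by (auto simp: prefix_append)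
  then show ?case
  proof cases
    case 1
    then have "length w \<le> l" using l[of a] prefix_length_le order_trans by blast
    then show ?thesis by (intro exI[of _ "[]"] exI[of _ w]) simp
  next
    case 2
    obtain w' p where w': "w2 = \<tau> w' @ p" "prefix w' u" "length p \<le> l"
      using Cons.IH[OF 2(2)] by blast
    then show ?thesis using 2(1)
      by (intro exI[of _ "a # w'"] exI[of _ p]) (simp add: image_Cons[of a w'])
  qed
qed

lemma sublist_of_image:
  assumes "sublist w (\<tau> u)" and l: "\<And>a. length (\<tau> [a]) \<le> l"
  shows "\<exists>s w' p. w = s @ \<tau> w' @ p \<and> sublist w' u \<and> length s \<le> l \<and> length p \<le> l"
  using assms(1)
proof (induction u arbitrary: w)
  case Nil
  then show ?case by (auto intro: exI[of _ "[]"])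
next
  case (Cons a u)
  have "sublist w (\<tau> [a] @ \<tau> u)" using Cons.prems by (simp add: image_Cons[of a u])
  then consider "sublist w (\<tau> [a])" | "sublist w (\<tau> u)"
    | s w2 where "w = s @ w2" "suffix s (\<tau> [a])" "prefix w2 (\<tau> u)"
    by (auto simp: sublist_append)
  then show ?case
  proof cases
    case 1
    then have "length w \<le> l" using l[of a] sublist_length_le order_trans by blast
    then show ?thesis by (intro exI[of _ w] exI[of _ "[]"]) simp
  next
    case 2
    then obtain s w' p where "w = s @ \<tau> w' @ p" "sublist w' u" "length s \<le> l" "length p \<le> l"
      using Cons.IH by blast
    moreover have "sublist w' (a # u)"
      using \<open>sublist w' u\<close> sublist_append_leftI[of u "[a]"] sublist_order.order.trans by fastforce
    ultimately show ?thesis by blast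
  next
    case 3
    obtain w' p where w': "w2 = \<tau> w' @ p" "prefix w' u" "length p \<le> l"
      using prefix_of_image[OF 3(3) l] by blast
    have "length s \<le> l" using l[of a] suffix_length_le[OF 3(2)] by linarith
    moreover have "sublist w' (a # u)"
      using prefix_imp_sublist[OF w'(2)] sublist_append_leftI[of u "[a]"] sublist_order.order.trans
      by fastforce
    ultimately show ?thesis using 3(1) w' by blast
  qed
qed

text \<open>Desubstituting a factor of an iterated image level by level removes a bounded number of
  letters at each end of each level; on level \<open>i\<close> these are weighted by \<open>(T ^^ i) v\<close>.\<close>

lemma abs_weight_iterated_image:
  assumes l: "\<And>a. length (\<tau> [a]) \<le> l"
  shows "sublist w ((\<tau> ^^ n) [a]) \<Longrightarrow>
    \<bar>weight v w\<bar> \<le> 2 * real l * (\<Sum>i<n. norm ((T ^^ i) v)) + norm ((T ^^ n) v)"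
proof (induction n arbitrary: w v)
  case 0
  then have "length w \<le> 1" using sublist_length_le by fastforce
  then have "real (length w) * norm v \<le> 1 * norm v" by (intro mult_right_mono) auto
  then show ?case using abs_weight_le[of v w] by simp
next
  case (Suc n)
  then have "sublist w (\<tau> ((\<tau> ^^ n) [a]))" by simp
  from sublist_of_image[OF this l] obtain s w' p where
    w: "w = s @ \<tau> w' @ p" "sublist w' ((\<tau> ^^ n) [a])" "length s \<le> l" "length p \<le> l"
    by blast
  have ends: "\<bar>weight v u\<bar> \<le> real l * norm v" if "length u \<le> l" for u
    using abs_weight_le[of v u] that by (meson mult_right_mono norm_ge_zero of_nat_mono order_trans)
  have "\<bar>weight v w\<bar> \<le> 2 * (real l * norm v) + \<bar>weight (T v) w'\<bar>"
    using ends[OF w(3)] ends[OF w(4)] by (simp add: w(1) weight_T)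
  also have "\<bar>weight (T v) w'\<bar> \<le>
      2 * real l * (\<Sum>i<n. norm ((T ^^ i) (T v))) + norm ((T ^^ n) (T v))"
    by (rule Suc.IH[OF w(2)])
  finally show ?case
    by (simp add: sum.lessThan_Suc_shift funpow_swap1 distrib_left del: sum.lessThan_Suc)
qed

lemma stable_space_subset_bounded_weights: "stable_space \<tau> \<subseteq> D"
proof
  fix v assume "v \<in> stable_space \<tau>"
  then have v: "(\<lambda>n. (T ^^ n) v) \<longlonglongrightarrow> 0" by (simp add: stable_space_iff)
  define l where "l = Max (range (\<lambda>a. length (\<tau> [a])))"
  have l: "length (\<tau> [a]) \<le> l" for a unfolding l_def by (intro Max_ge) auto
  note sm = summable_norm_orbit[OF linear_T v]
  define S where "S = (\<Sum>i. norm ((T ^^ i) v))"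
  have part: "(\<Sum>i<n. norm ((T ^^ i) v)) \<le> S" for n
    unfolding S_def by (intro sum_le_suminf sm) auto
  show "v \<in> D"
  proof (rule bounded_weightsI)
    fix w assume "w \<in> language X"
    then obtain n a where "sublist w ((\<tau> ^^ n) [a])"
      by (auto simp: language_subst_shift substitution_words_def)
    then have "\<bar>weight v w\<bar> \<le> 2 * real l * (\<Sum>i<n. norm ((T ^^ i) v)) + norm ((T ^^ n) v)"
      by (rule abs_weight_iterated_image[OF l])
    also have "norm ((T ^^ n) v) \<le> S"
    proof -
      have "norm ((T ^^ n) v) \<le> (\<Sum>i<Suc n. norm ((T ^^ i) v))" by (simp add: sum_nonneg)
      then show ?thesis using part[of "Suc n"] by linarith
    qed
    also have "2 * real l * (\<Sum>i<n. norm ((T ^^ i) v)) \<le> 2 * real l * S"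
      by (intro mult_left_mono part) simp
    finally show "\<bar>weight v w\<bar> \<le> 2 * real l * S + S" by simp
  qed
qed


subsection \<open>Bounded weights are asymptotically coboundaries\<close>

text \<open>Choose a word \<open>z\<close> whose weight is within \<open>e\<close> of the supremum. For large \<open>n\<close> it occurs in
  \<open>(\<tau> ^^ n) [a]\<close>, hence after a prefix \<open>u\<close> of it. If \<open>w @ [a]\<close> starts with \<open>a\<close>, then
  \<open>(\<tau> ^^ n) (w @ [a])\<close> starts with \<open>u\<close> and also with \<open>(\<tau> ^^ n) w @ u @ z\<close>. Removing the first
  \<open>u\<close> from the latter leaves a word of weight \<open>weight v ((\<tau> ^^ n) w) + weight v z\<close>, which does
  not exceed the supremum.\<close>

lemma eventually_weight_image_le:
  assumes v: "v \<in> D" and wa: "w @ [a] \<in> language X" "prefix [a] (w @ [a])" and e: "0 < e"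
  shows "\<forall>\<^sub>F n in sequentially. weight v ((\<tau> ^^ n) w) \<le> e"
proof -
  obtain K where K: "\<And>u. u \<in> language X \<Longrightarrow> \<bar>weight v u\<bar> \<le> K"
    using v unfolding bounded_weights_def by blast
  define M where "M = (SUP u\<in>language X. weight v u)"
  have bdd: "bdd_above (weight v ` language X)"
    using K by (intro bdd_aboveI2[where M = K]) (auto simp: abs_le_iff)
  have M: "weight v u \<le> M" if "u \<in> language X" for u
    unfolding M_def by (rule cSUP_upper[OF that bdd])
  have "M - e < M" using e by simp
  then obtain z where z: "z \<in> language X" "weight v z > M - e"
    using wa(1) unfolding M_def by (subst (asm) less_cSUP_iff[OF _ bdd]) auto
  obtain N where N: "\<And>n. n \<ge> N \<Longrightarrow> sublist z ((\<tau> ^^ n) [a])"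
    using word_occurs_eventually z(1) unfolding language_subst_shift by blast
  obtain r where r: "w @ [a] = [a] @ r" using wa(2) by (auto simp: prefix_def)
  have "weight v ((\<tau> ^^ n) w) \<le> e" if n: "n \<ge> N" for n
  proof -
    obtain u s where us: "(\<tau> ^^ n) [a] = u @ z @ s" using N[OF n] by (auto simp: sublist_def)
    have eq: "((\<tau> ^^ n) w @ u @ z) @ s = u @ (z @ s @ (\<tau> ^^ n) r)"
      using arg_cong[OF r, of "\<tau> ^^ n"] by (simp only: funpow_append us append.assoc)
    have "prefix u (u @ (z @ s @ (\<tau> ^^ n) r))" "prefix ((\<tau> ^^ n) w @ u @ z) (u @ (z @ s @ (\<tau> ^^ n) r))"
      by (simp, metis eq prefixI)
    then have "prefix u ((\<tau> ^^ n) w @ u @ z)"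
      by (rule prefix_length_prefix) simp
    then obtain y where y: "(\<tau> ^^ n) w @ u @ z = u @ y" by (auto simp: prefix_def)
    have "(\<tau> ^^ n) (w @ [a]) = u @ y @ s"
      using y by (simp add: funpow_append us)
    then have "sublist y ((\<tau> ^^ n) (w @ [a]))" by (metis sublist_appendI)
    then have "weight v y \<le> M"
      using M language_sublist image_in_language[OF wa(1)] by blast
    moreover have "weight v ((\<tau> ^^ n) w) + weight v z = weight v y"
      using arg_cong[OF y, of "weight v"] by simp
    ultimately show ?thesis using z(2) by linarith
  qed
  then show ?thesis by (auto simp: eventually_sequentially)
qed

lemma weight_image_return_word_tendsto_0:
  assumes v: "v \<in> D" and w: "return_word X a w"
  shows "(\<lambda>n. weight v ((\<tau> ^^ n) w)) \<longlonglongrightarrow> 0"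
proof (rule tendstoI)
  fix e :: real assume e: "0 < e"
  have wa: "w @ [a] \<in> language X" "prefix [a] (w @ [a])" using w by (auto simp: return_word_def)
  have "- v \<in> D" using v by (rule subspace_neg[OF subspace_bounded_weights])
  then have "\<forall>\<^sub>F n in sequentially. weight (- v) ((\<tau> ^^ n) w) \<le> e/2"
    "\<forall>\<^sub>F n in sequentially. weight v ((\<tau> ^^ n) w) \<le> e/2"
    using eventually_weight_image_le[OF \<open>- v \<in> D\<close> wa, of "e/2"]
      eventually_weight_image_le[OF v wa, of "e/2"] e by auto
  then show "\<forall>\<^sub>F n in sequentially. dist (weight v ((\<tau> ^^ n) w)) 0 < e"
    by eventually_elim (use e in \<open>simp add: weight_linear dist_real_def\<close>)
qed

lemma bounded_orbit:
  assumes "v \<in> D"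
  shows "bounded (range (\<lambda>n. (T ^^ n) v))"
proof -
  obtain K where K: "\<And>u. u \<in> language X \<Longrightarrow> \<bar>weight v u\<bar> \<le> K"
    using assms unfolding bounded_weights_def by blast
  have "norm ((T ^^ n) v) \<le> real CARD('a) * K" for n
  proof -
    have "norm ((T ^^ n) v) \<le> (\<Sum>a\<in>UNIV. \<bar>weight ((T ^^ n) v) [a]\<bar>)" by (rule norm_le_weights)
    also have "\<dots> \<le> (\<Sum>a\<in>(UNIV :: 'a set). K)"
      unfolding weight_funpow_T
      by (intro sum_mono K image_in_language letter_in_language)
    finally show ?thesis by simp
  qed
  then show ?thesis by (auto simp: bounded_iff)
qed

lemma T_bounded_weights:
  assumes "v \<in> D"
  shows "T v \<in> D"
proof -
  obtain K where K: "\<And>u. u \<in> language X \<Longrightarrow> \<bar>weight v u\<bar> \<le> K"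
    using assms unfolding bounded_weights_def by blast
  show ?thesis
    using K image_in_language[of _ 1] by (intro bounded_weightsI[of _ _ K]) (simp add: weight_T)
qed

text \<open>A limit point of the orbit of a vector with bounded weights is a coboundary, because the
  weights of return words tend to zero along the orbit; the difference to such a limit point can be
  made stable.\<close>

theorem bounded_weights_eq_stable_plus_coboundary:
  "D = stable_space \<tau> + coboundary_space X"
proof
  show "stable_space \<tau> + coboundary_space X \<subseteq> D"
  proof
    fix x assume "x \<in> stable_space \<tau> + coboundary_space X"
    then obtain v c where "x = v + c" "v \<in> stable_space \<tau>" "c \<in> coboundary_space X"
      by (rule set_plus_elim)
    then show "x \<in> D"
      using stable_space_subset_bounded_weights coboundary_space_subset_bounded_weights
      by (auto intro: subspace_add[OF subspace_bounded_weights])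
  qed
next
  show "D \<subseteq> stable_space \<tau> + coboundary_space X"
  proof
    fix v assume v: "v \<in> D"
    obtain c m where m: "filterlim m at_top sequentially" and c: "(\<lambda>j. (T ^^ m j) v) \<longlonglongrightarrow> c"
      and vc: "(\<lambda>n. (T ^^ n) (v - c)) \<longlonglongrightarrow> 0"
      using bounded_orbit_splitting[OF linear_T subspace_bounded_weights T_bounded_weights
          bounded_orbit v] by metis
    have "weight c w = 0" if "return_word X a w" for a w
    proof (rule LIMSEQ_unique)
      show "(\<lambda>j. weight ((T ^^ m j) v) w) \<longlonglongrightarrow> weight c w" by (rule tendsto_weight[OF c])
      show "(\<lambda>j. weight ((T ^^ m j) v) w) \<longlonglongrightarrow> 0"
        unfolding weight_funpow_T
        by (rule filterlim_compose[OF weight_image_return_word_tendsto_0[OF v that] m])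
    qed
    then have "c \<in> coboundary_space X" by (simp add: coboundary_space_iff)
    moreover have "v - c \<in> stable_space \<tau>" using vc by (simp add: stable_space_iff)
    ultimately show "v \<in> stable_space \<tau> + coboundary_space X"
      using set_plus_intro[of "v - c" "stable_space \<tau>" c "coboundary_space X"] by simp
  qed
qed

end


section \<open>The criterion for letter-balance\<close>

theorem theorem6p2:
  fixes \<tau> :: "'a::finite list \<Rightarrow> 'a list"
  assumes "CARD('a) \<ge> 2"
    and "substitution \<tau>"
    and "primitive \<tau>"
    and "aperiodic \<tau>"
  shows "letter_balanced (subst_shift \<tau>) \<longleftrightarrow>
    codim (stable_space \<tau> + coboundary_space (subst_shift \<tau>)) = 1"
proof -
  interpret primitive_substitution \<tau>
    using assms(1-3) by unfold_locales
  show ?thesis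
    using letter_balanced_iff_codim_bounded_weights[OF subst_shift_nonempty]
    unfolding bounded_weights_eq_stable_plus_coboundary .
qed

end
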